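(* Let $k\ge 2$, let $0=r_0<r_1<\dots<r_k$ be integers, $d=\gcd(r_1,\dots,r_k)$, $S=\langle r_1,\dots,r_k\rangle$, and $N_0=\max\{r_k^2,\ r_k^2+\operatorname{F}(S)r_k\}$. For a positive integer $n$ with $\gcd(n,d)=1$ let $M_n=\langle n,n+r_1,\dots,n+r_k\rangle$ and $$P_n=\{i\in \operatorname{Ap}(S,dn)\mid f\equiv i \bmod n \text{ for some } f\in \operatorname{PF}(M_n)\}.$$ If $n>N_0$ and $\gcd(n,d)=1$, then the map $\psi_n:P_n\to P_{n+r_k}$ given by $$\psi_n(i)=\begin{cases} i & \text{if } i<dn-r_k,\\ i+dr_k & \text{if } i\ge dn-r_k\end{cases}$$ is (well defined and) a bijection. In particular, it induces a bijection $\varphi_n:\operatorname{PF}(M_n)\to\operatorname{PF}(M_{n+r_k})$, where for $f\in \operatorname{PF}(M_n)$ with $f\equiv i\bmod n$, $i\in P_n$, $\varphi_n(f)$ is the unique element of $\operatorname{PF}(M_{n+r_k})$ congruent to $\psi_n(i)$ modulo $n+r_k$.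
   Context: $\mathbb{N}$ includes $0$, and $\langle a_1,\dots,a_s\rangle=\{\sum\lambda_i a_i\mid \lambda_i\in\mathbb{N}\}$. A numerical semigroup is an additive submonoid $H\subseteq\mathbb{N}$ with $\mathbb{N}\setminus H$ finite; $M_n$ is one exactly when $\gcd(n,d)=1$. For a numerical semigroup $H$, $\operatorname{PF}(H)=\{x\in\mathbb{Z}\setminus H\mid x+h\in H\ \text{for all } 0\ne h\in H\}$ and $\operatorname{F}(H)=\max(\mathbb{Z}\setminus H)$. For the monoid $S$, whose elements have greatest common divisor $d$, $\operatorname{F}(S)=\max\{s\in\mathbb{Z}\setminus S\mid s\equiv 0 \bmod d\}$ (this may be negative, e.g. it equals $-d$ when $S=d\mathbb{N}$). $\operatorname{Ap}(S,dn)=\{s\in S\mid s-dn\notin S\}$. For $n>N_0$, $\gcd(n,d)=1$, one has $dn\in S$, every $f\in\operatorname{PF}(M_n)$ is congruent modulo $n$ to a unique element $i\in \operatorname{Ap}(S,dn)$, and $f\mapsto i$ is a bijection $\operatorname{PF}(M_n)\to P_n$; this identification is what is meant by "induces". *)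

theory Defs
  imports "HOL-Number_Theory.Cong"
begin

text \<open>All monoids are represented as subsets of \<open>\<int>\<close>, since pseudo-Frobenius
  numbers and Frobenius numbers are integers that may be negative.
  A sequence of generators is a function on indices, of which only those in \<open>I\<close> matter.\<close>

definition gen_monoid :: "nat set \<Rightarrow> (nat \<Rightarrow> int) \<Rightarrow> int set" where
  "gen_monoid I a = {(\<Sum>i\<in>I. int (l i) * a i) | l :: nat \<Rightarrow> nat. True}"

definition PF :: "int set \<Rightarrow> int set" where
  "PF H = {x. x \<notin> H \<and> (\<forall>h\<in>H. h \<noteq> 0 \<longrightarrow> x + h \<in> H)}"

text \<open>The maximum ranges over a set that is unbounded below, so \<^const>\<open>Max\<close>, which is
  meaningful for finite sets only, cannot be used.\<close>

definition frobenius :: "int set \<Rightarrow> int" where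
  "frobenius H = (GREATEST s. s \<notin> H \<and> [s = 0] (mod (Gcd H)))"

definition Ap :: "int set \<Rightarrow> int \<Rightarrow> int set" where
  "Ap H m = {s \<in> H. s - m \<notin> H}"

definition gcd_shifts :: "nat \<Rightarrow> (nat \<Rightarrow> int) \<Rightarrow> int" where
  "gcd_shifts k r = Gcd (r ` {1..k})"

definition shift_monoid :: "nat \<Rightarrow> (nat \<Rightarrow> int) \<Rightarrow> int set" where
  "shift_monoid k r = gen_monoid {1..k} r"

text \<open>Index \<open>0\<close> contributes the generator \<open>n\<close>, as \<open>r 0 = 0\<close> throughout.\<close>

definition M :: "nat \<Rightarrow> (nat \<Rightarrow> int) \<Rightarrow> int \<Rightarrow> int set" where
  "M k r n = gen_monoid {0..k} (\<lambda>i. n + r i)"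

definition N0 :: "nat \<Rightarrow> (nat \<Rightarrow> int) \<Rightarrow> int" where
  "N0 k r = max ((r k)\<^sup>2) ((r k)\<^sup>2 + frobenius (shift_monoid k r) * r k)"

definition P :: "nat \<Rightarrow> (nat \<Rightarrow> int) \<Rightarrow> int \<Rightarrow> int set" where
  "P k r n = {i \<in> Ap (shift_monoid k r) (gcd_shifts k r * n). \<exists>f\<in>PF (M k r n). [f = i] (mod n)}"

definition psi :: "nat \<Rightarrow> (nat \<Rightarrow> int) \<Rightarrow> int \<Rightarrow> int \<Rightarrow> int" where
  "psi k r n i = (if i < gcd_shifts k r * n - r k then i else i + gcd_shifts k r * r k)"

end

theory Submission
  imports Defs
begin

text \<open>Put \<open>A = {r\<^sub>0, \<dots>, r\<^sub>k}\<close>, \<open>R = r\<^sub>k\<close>, and let \<open>len s\<close> be the least number of generators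
  with sum \<open>s \<in> S\<close>. A sum of \<open>L\<close> of the numbers \<open>n + r\<^sub>j\<close> is \<open>L * n + s\<close> with \<open>s\<close> a sum of \<open>L\<close>
  elements of \<open>A\<close>, so \<open>M\<^sub>n\<close> is governed by the length function of \<open>S\<close>. A pigeonhole argument
  modulo \<open>R\<close> (\<open>shortest_factorisation\<close>) shows that a shortest factorisation has fewer than \<open>R\<close>
  summands other than \<open>R\<close>. Hence \<open>len s\<close> differs from \<open>s / R\<close> by less than \<open>R\<close>, and
  \<open>len (s + R) = len s + 1\<close> once \<open>s > R\<^sup>2 - R\<close>.

  Since \<open>n > R\<^sup>2\<close>, the first of these consequences makes \<open>i + len i * n\<close>, for \<open>i \<in> Ap(S, d * n)\<close>,
  the least element of \<open>M\<^sub>n\<close> in its class modulo \<open>n\<close> (\<open>Apery_mem_shifted_iff\<close>). A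
  pseudo-Frobenius number \<open>f\<close> has \<open>f \<notin> M\<^sub>n\<close> but \<open>f + n \<in> M\<^sub>n\<close>, so it is
  \<open>i + (len i - 1) * n\<close> for one such \<open>i\<close>; and \<open>f + (n + r\<^sub>j) \<in> M\<^sub>n\<close> says that
  \<open>len (i + r\<^sub>j) \<le> len i\<close> whenever \<open>i + r\<^sub>j\<close> is still in the Apery set. So \<open>P\<^sub>n\<close> is the set of
  \<open>i\<close> at which no generator increases the length inside \<open>Ap(S, d * n)\<close>
  (\<open>PF_shifted\<close>, \<open>maximal_eq\<close>).

  This description is compared for \<open>n\<close> and \<open>n + R\<close>. Below \<open>d * n - R\<close> both Apery sets coincide
  with \<open>S\<close>, also after adding a generator, and the conditions are identical. From \<open>d * n - R\<close>
  on, translation by \<open>d * R\<close> matches the Apery sets and adds \<open>d\<close> to all lengths involved. What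
  remains for \<open>n + R\<close> is the interval from \<open>d * n - R\<close> to \<open>d * (n + R) - R\<close>, and it contains no
  element of \<open>P\<^bsub>n + R\<^esub>\<close>: adding \<open>R\<close> there stays in the Apery set and increases the length.\<close>

section \<open>Sums of a prescribed number of generators\<close>

definition sums_of :: "int set \<Rightarrow> nat \<Rightarrow> int set" where
  "sums_of A L = {sum_list xs | xs. set xs \<subseteq> A \<and> length xs = L}"

lemma sums_of_add:
  assumes "s \<in> sums_of A L" "t \<in> sums_of A L'"
  shows "s + t \<in> sums_of A (L + L')"
proof -
  obtain xs ys where "set xs \<subseteq> A" "length xs = L" "s = sum_list xs"
    "set ys \<subseteq> A" "length ys = L'" "t = sum_list ys"
    using assms by (auto simp: sums_of_def)
  then have "set (xs @ ys) \<subseteq> A \<and> length (xs @ ys) = L + L' \<and> s + t = sum_list (xs @ ys)"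
    by simp
  then show ?thesis unfolding sums_of_def by blast
qed

lemma Union_sums_of_add:
  assumes "s \<in> (\<Union>L. sums_of A L)" "t \<in> (\<Union>L. sums_of A L)"
  shows "s + t \<in> (\<Union>L. sums_of A L)"
proof -
  obtain L L' where "s \<in> sums_of A L" "t \<in> sums_of A L'" using assms by auto
  then have "s + t \<in> sums_of A (L + L')" by (rule sums_of_add)
  then show ?thesis by (rule UN_I[OF UNIV_I])
qed

lemma sums_of_multiple: "a \<in> A \<Longrightarrow> int L * a \<in> sums_of A L"
  unfolding sums_of_def
  by (auto intro!: exI[of _ "replicate L a"] simp: sum_list_replicate)

lemma sums_of_single: "a \<in> A \<Longrightarrow> a \<in> sums_of A 1"
  using sums_of_multiple[of a A 1] by simp

lemma zero_sums_of: "0 \<in> sums_of A 0"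
  by (auto simp: sums_of_def)

lemma sums_of_SucE:
  assumes "s \<in> sums_of A (Suc L)"
  obtains a t where "a \<in> A" "t \<in> sums_of A L" "s = a + t"
proof -
  obtain xs where xs: "set xs \<subseteq> A" "length xs = Suc L" "s = sum_list xs"
    using assms by (auto simp: sums_of_def)
  then obtain a ys where "xs = a # ys" by (cases xs) auto
  then show thesis using xs that[of a "sum_list ys"] by (auto simp: sums_of_def)
qed

lemma gen_monoid_add_generator:
  assumes "finite I" "i \<in> I" "x \<in> gen_monoid I a"
  shows "a i + x \<in> gen_monoid I a"
proof -
  obtain l :: "nat \<Rightarrow> nat" where l: "x = (\<Sum>j\<in>I. int (l j) * a j)"
    using assms(3) by (auto simp: gen_monoid_def)
  have "a i + x = (\<Sum>j\<in>I. int ((l(i := Suc (l i))) j) * a j)"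
    using assms(1,2) unfolding l by (simp add: sum.remove[of I i] algebra_simps)
  then show ?thesis unfolding gen_monoid_def by blast
qed

lemma gen_monoid_eq_sums_of:
  assumes "finite I"
  shows "gen_monoid I a = (\<Union>L. sums_of (a ` I) L)"
proof
  have "(\<Sum>j\<in>J. int (l j) * a j) \<in> (\<Union>L. sums_of (a ` I) L)"
    if "J \<subseteq> I" "finite J" for J and l :: "nat \<Rightarrow> nat"
    using that(2,1)
  proof (induction J rule: finite_induct)
    case empty
    show ?case using zero_sums_of by auto
  next
    case (insert j J)
    then obtain L where "(\<Sum>j\<in>J. int (l j) * a j) \<in> sums_of (a ` I) L" by auto
    moreover have "int (l j) * a j \<in> sums_of (a ` I) (l j)"
      using insert.prems by (intro sums_of_multiple) auto
    ultimately show ?case using insert.hyps sums_of_add by fastforce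
  qed
  then show "gen_monoid I a \<subseteq> (\<Union>L. sums_of (a ` I) L)"
    using assms by (auto simp: gen_monoid_def)
next
  have "s \<in> gen_monoid I a" if "s \<in> sums_of (a ` I) L" for s L
    using that
  proof (induction L arbitrary: s)
    case 0
    then have "s = (\<Sum>j\<in>I. int 0 * a j)" by (auto simp: sums_of_def)
    then show ?case by (auto simp: gen_monoid_def intro!: exI[of _ "\<lambda>_. 0"])
  next
    case (Suc L)
    then show ?case
      by (elim sums_of_SucE) (auto intro: gen_monoid_add_generator[OF assms])
  qed
  then show "(\<Union>L. sums_of (a ` I) L) \<subseteq> gen_monoid I a" by auto
qed

lemma sums_of_shift:
  "sums_of ((\<lambda>a. n + a) ` A) L = (\<lambda>s. int L * n + s) ` sums_of A L"
proof (induction L)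
  case 0
  show ?case by (auto simp: sums_of_def)
next
  case (Suc L)
  show ?case
  proof safe
    fix x assume "x \<in> sums_of ((\<lambda>a. n + a) ` A) (Suc L)"
    then obtain a t where "a \<in> A" "t \<in> sums_of A L" "x = n + a + (int L * n + t)"
      using Suc by (elim sums_of_SucE) auto
    then show "x \<in> (\<lambda>s. int (Suc L) * n + s) ` sums_of A (Suc L)"
      using sums_of_add[OF sums_of_single, of a A t L]
      by (intro image_eqI[of _ _ "a + t"]) (auto simp: algebra_simps)
  next
    fix s assume "s \<in> sums_of A (Suc L)"
    then obtain a t where at: "a \<in> A" "t \<in> sums_of A L" "s = a + t"
      by (rule sums_of_SucE)
    then have "int L * n + t \<in> sums_of ((\<lambda>a. n + a) ` A) L" using Suc by auto
    with at(1) have "(n + a) + (int L * n + t) \<in> sums_of ((\<lambda>a. n + a) ` A) (1 + L)"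
      by (intro sums_of_add sums_of_single) auto
    then show "int (Suc L) * n + s \<in> sums_of ((\<lambda>a. n + a) ` A) (Suc L)"
      using at(3) by (simp add: algebra_simps)
  qed
qed

text \<open>Two of the first \<open>R + 1\<close> partial sums agree modulo \<open>R\<close>; the block between them is
  the required one.\<close>

lemma block_sum_divisible:
  fixes xs :: "int list" and R :: int
  assumes "0 < R" "R \<le> int (length xs)"
  obtains us vs ws where "xs = us @ vs @ ws" "vs \<noteq> []" "R dvd sum_list vs"
proof -
  define p where "p i = sum_list (take i xs) mod R" for i
  have "p ` {0..nat R} \<subseteq> {0..<R}" using assms(1) by (auto simp: p_def)
  then have "card (p ` {0..nat R}) \<le> card {0..<R}" by (intro card_mono) auto
  then have "\<not> inj_on p {0..nat R}" using card_image[of p "{0..nat R}"] by auto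
  then obtain i j where ij: "i < j" "j \<le> nat R" "p i = p j"
    unfolding inj_on_def by (metis atLeastAtMost_iff linorder_neqE_nat)
  define vs where "vs = drop i (take j xs)"
  have tj: "take j xs = take i xs @ vs"
    using ij(1) append_take_drop_id[of i "take j xs"] by (simp add: vs_def min_def)
  have "length vs = j - i" using ij assms by (auto simp: vs_def min_def)
  moreover have "R dvd sum_list vs"
  proof -
    have "R dvd sum_list (take j xs) - sum_list (take i xs)"
      using ij(3) unfolding p_def by (metis mod_eq_dvd_iff)
    then show ?thesis by (simp add: tj)
  qed
  moreover have "xs = take i xs @ vs @ drop j xs"
    using append_take_drop_id[of j xs] tj by simp
  ultimately show thesis using that ij(1) by fastforce
qed

section \<open>Minimal factorisation lengths\<close>

text \<open>Because \<open>0 \<in> A\<close>, a sum of exactly \<open>L\<close> generators is the same thing as a sum of at most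
  \<open>L\<close> nonzero ones, and \<open>n\<close> itself is among the numbers \<open>n + a\<close>.\<close>

locale generators =
  fixes A :: "int set" and R :: int
  assumes zero_mem: "0 \<in> A" and max_mem: "R \<in> A" and R_pos: "0 < R"
    and bounds: "a \<in> A \<Longrightarrow> 0 \<le> a \<and> a \<le> R"
begin

abbreviation "d \<equiv> Gcd A"

definition S :: "int set" where "S = (\<Union>L. sums_of A L)"

definition len :: "int \<Rightarrow> nat" where "len s = (LEAST L. s \<in> sums_of A L)"

definition shifted :: "int \<Rightarrow> int set" where
  "shifted n = (\<Union>L. sums_of ((\<lambda>a. n + a) ` A) L)"

lemma sums_of_mono:
  assumes "s \<in> sums_of A L" "L \<le> L'"
  shows "s \<in> sums_of A L'"
  using sums_of_add[OF assms(1) sums_of_multiple[OF zero_mem, of "L' - L"]] assms(2) by simp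

lemma sums_of_iff: "s \<in> sums_of A L \<longleftrightarrow> s \<in> S \<and> len s \<le> L"
proof
  assume "s \<in> sums_of A L"
  then show "s \<in> S \<and> len s \<le> L" by (auto simp: S_def len_def intro: Least_le)
next
  assume s: "s \<in> S \<and> len s \<le> L"
  then have "s \<in> sums_of A (len s)" unfolding S_def len_def by (auto intro: LeastI)
  then show "s \<in> sums_of A L" using s sums_of_mono by blast
qed

lemma S_add: "s \<in> S \<Longrightarrow> t \<in> S \<Longrightarrow> s + t \<in> S"
  unfolding S_def by (rule Union_sums_of_add)

lemma zero_S: "0 \<in> S"
  unfolding S_def using zero_sums_of by blast

lemma S_multiple: "s \<in> S \<Longrightarrow> int c * s \<in> S"
  by (induction c) (auto simp: zero_S algebra_simps intro: S_add)

lemma generator_S: "a \<in> A \<Longrightarrow> a \<in> S"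
  unfolding S_def using sums_of_single by blast

lemma S_nonneg: assumes "s \<in> S" shows "0 \<le> s"
  using assms bounds by (auto simp: S_def sums_of_def intro!: sum_list_nonneg)

lemma sums_of_le: assumes "s \<in> sums_of A L" shows "s \<le> int L * R"
  using assms
proof (induction L arbitrary: s)
  case (Suc L)
  then obtain a t where "a \<in> A" "t \<in> sums_of A L" "s = a + t" by (auto elim: sums_of_SucE)
  then show ?case using Suc.IH[of t] bounds[of a] by (simp add: algebra_simps)
qed (auto simp: sums_of_def)

lemma le_len_R: "s \<in> S \<Longrightarrow> s \<le> int (len s) * R"
  using sums_of_iff sums_of_le by blast

lemma len_add: "s \<in> S \<Longrightarrow> t \<in> S \<Longrightarrow> len (s + t) \<le> len s + len t"
  using sums_of_add[of s A "len s" t "len t"] by (simp add: sums_of_iff)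

lemma len_generator: "a \<in> A \<Longrightarrow> len a \<le> 1"
  using sums_of_single sums_of_iff by blast

lemma d_dvd_S: assumes "s \<in> S" shows "d dvd s"
proof -
  have "d dvd sum_list xs" if "set xs \<subseteq> A" for xs
    using that by (induction xs) (auto intro: dvd_add)
  then show ?thesis using assms by (auto simp: S_def sums_of_def)
qed

lemma d_pos: "0 < d"
proof -
  have "d \<noteq> 0" using max_mem R_pos by (metis Gcd_dvd dvd_0_left less_irrefl)
  moreover have "0 \<le> d" by simp
  ultimately show ?thesis by linarith
qed

lemma dvd_R: "d dvd R" using max_mem by (rule Gcd_dvd)

text \<open>In a shortest factorisation fewer than \<open>R\<close> summands differ from \<open>R\<close>: among \<open>R\<close> of them
  there would be a block with sum \<open>q * R\<close>, and since every summand of the block is below \<open>R\<close>,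
  trading it for \<open>q\<close> copies of \<open>R\<close> would shorten the factorisation.\<close>

lemma shortest_factorisation:
  assumes "s \<in> S"
  obtains b t where "len s = b + t" "int t < R" "s - int b * R \<in> sums_of A t"
proof -
  obtain xs where xs: "set xs \<subseteq> A" "length xs = len s" "s = sum_list xs"
    using assms sums_of_iff[of s "len s"] by (auto simp: sums_of_def)
  define ys where "ys = filter (\<lambda>x. x \<noteq> R) xs"
  define b where "b = length (filter (\<lambda>x. x = R) xs)"
  have "length xs = b + length ys \<and> sum_list xs = int b * R + sum_list ys"
    unfolding b_def ys_def by (induction xs) (auto simp: algebra_simps)
  then have split: "len s = b + length ys" "s = int b * R + sum_list ys" using xs by auto
  have ysA: "set ys \<subseteq> A" "\<forall>y\<in>set ys. y < R" using xs(1) bounds by (force simp: ys_def)+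
  have "int (length ys) < R"
  proof (rule ccontr)
    assume "\<not> int (length ys) < R"
    then obtain us vs ws where blk: "ys = us @ vs @ ws" "vs \<noteq> []" "R dvd sum_list vs"
      using block_sum_divisible[of R ys] R_pos by auto
    have strict: "zs \<noteq> [] \<Longrightarrow> \<forall>y\<in>set zs. y < R \<Longrightarrow> sum_list zs < int (length zs) * R" for zs
    proof (induction zs)
      case (Cons z zs)
      then show ?case by (cases "zs = []") (auto simp: algebra_simps)
    qed simp
    have "sum_list vs < int (length vs) * R" using strict[OF blk(2)] ysA(2) blk(1) by auto
    moreover have "0 \<le> sum_list vs"
      using ysA(1) bounds blk(1) by (intro sum_list_nonneg) auto
    moreover obtain q where q: "sum_list vs = q * R" using blk(3) by (metis dvd_def mult.commute)
    ultimately have q0: "0 \<le> q" and ql: "q < int (length vs)"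
      using R_pos by (auto simp: zero_le_mult_iff)
    have "int (nat q + b) * R \<in> sums_of A (nat q + b)"
      by (rule sums_of_multiple[OF max_mem])
    moreover have "sum_list (us @ ws) \<in> sums_of A (length (us @ ws))"
      using ysA(1) blk(1) unfolding sums_of_def by fastforce
    ultimately have "int (nat q + b) * R + sum_list (us @ ws)
        \<in> sums_of A (nat q + b + length (us @ ws))"
      by (rule sums_of_add)
    also have "int (nat q + b) * R + sum_list (us @ ws) = s"
      using q0 q split(2) blk(1) by (simp add: algebra_simps)
    finally have "len s \<le> nat q + b + length (us @ ws)" by (simp add: sums_of_iff)
    then show False using split(1) blk(1) ql q0 by simp
  qed
  moreover have "s - int b * R \<in> sums_of A (length ys)"
    using split(2) ysA(1) by (auto simp: sums_of_def)
  ultimately show thesis using that split(1) by blast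
qed

lemma len_R_le: assumes "s \<in> S" shows "int (len s) * R \<le> s + R\<^sup>2 - R"
proof -
  obtain b t where bt: "len s = b + t" "int t < R" "s - int b * R \<in> sums_of A t"
    by (rule shortest_factorisation[OF assms])
  have "0 \<le> s - int b * R" using bt(3) S_nonneg sums_of_iff by blast
  moreover have "int t * R \<le> (R - 1) * R" using bt(2) R_pos by (intro mult_right_mono) auto
  ultimately show ?thesis using bt(1) by (simp add: algebra_simps power2_eq_square)
qed

text \<open>A large element has a shortest factorisation that uses \<open>R\<close>, since the fewer than \<open>R\<close>
  other summands add up to less than \<open>R\<^sup>2\<close>.\<close>

lemma len_add_R:
  assumes "s \<in> S" "R\<^sup>2 - R < s"
  shows "len (s + R) = len s + 1"
proof -
  have "s + R \<in> S" by (intro S_add assms(1) generator_S max_mem)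
  then obtain b t where bt: "len (s + R) = b + t" "int t < R"
      "s + R - int b * R \<in> sums_of A t"
    by (rule shortest_factorisation)
  have "s + R - int b * R \<le> int t * R" using bt(3) by (rule sums_of_le)
  moreover have "int t * R \<le> (R - 1) * R" using bt(2) R_pos by (intro mult_right_mono) auto
  ultimately have "0 < int b * R"
    using assms(2) R_pos by (simp add: algebra_simps power2_eq_square)
  then obtain b' where b': "b = Suc b'" by (cases b) auto
  have "int b' * R + (s + R - int b * R) \<in> sums_of A (b' + t)"
    using sums_of_multiple[OF max_mem] bt(3) by (rule sums_of_add)
  then have "len s \<le> b' + t" by (simp add: b' algebra_simps sums_of_iff)
  moreover have "len (s + R) \<le> len s + 1"
    using len_add[OF assms(1) generator_S[OF max_mem]] len_generator[OF max_mem] by simp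
  ultimately show ?thesis using bt(1) b' by simp
qed

lemma len_add_multiple_R:
  assumes "s \<in> S" "R\<^sup>2 - R < s"
  shows "len (s + int c * R) = len s + c"
proof (induction c)
  case (Suc c)
  have "s + int c * R \<in> S" by (intro S_add assms(1) S_multiple generator_S max_mem)
  moreover have "0 \<le> int c * R" using R_pos by simp
  then have "R\<^sup>2 - R < s + int c * R" using assms(2) by linarith
  ultimately have "len ((s + int c * R) + R) = len (s + int c * R) + 1" by (rule len_add_R)
  then show ?case using Suc by (simp add: algebra_simps)
qed simp

section \<open>The Frobenius number\<close>

lemma Gcd_S: "Gcd S = d"
proof (rule associated_eqI)
  show "Gcd S dvd d" by (rule Gcd_greatest) (rule Gcd_dvd[OF generator_S])
  show "d dvd Gcd S" by (rule Gcd_greatest) (rule d_dvd_S)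
qed auto

lemma finite_A: "finite A"
  using bounds by (intro finite_subset[of A "{0..R}"]) auto

text \<open>The integers that some multiple of \<open>R\<close> carries into \<open>S\<close> form a subgroup of \<open>\<int>\<close>, so by
  Bezout this subgroup contains the greatest common divisor of the generators.\<close>

lemma eventually_S:
  assumes "d dvd x"
  shows "\<exists>t. x + int t * R \<in> S"
proof -
  define G where "G = {x. \<exists>t. x + int t * R \<in> S}"
  have add: "x + y \<in> G" if xy: "x \<in> G" "y \<in> G" for x y
  proof -
    obtain t u where "x + int t * R \<in> S" "y + int u * R \<in> S" using xy by (auto simp: G_def)
    then have "(x + y) + int (t + u) * R \<in> S"
      using S_add[of "x + int t * R" "y + int u * R"] by (simp add: algebra_simps)
    then show ?thesis unfolding G_def by blast
  qed
  have zero: "0 \<in> G" using zero_S by (auto simp: G_def intro!: exI[of _ 0])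
  have neg: "- x \<in> G" if x: "x \<in> G" for x
  proof -
    obtain t where t: "x + int t * R \<in> S" using x by (auto simp: G_def)
    define u where "u = nat (x + int t * R)"
    have u: "int u = x + int t * R" using S_nonneg[OF t] by (simp add: u_def)
    \<comment> \<open>\<open>- x\<close> agrees with \<open>(R - 1) * (x + t * R)\<close> modulo \<open>R\<close>.\<close>
    have "int (nat (R - 1)) * (x + int t * R) + int t * R \<in> S"
      by (intro S_add S_multiple t generator_S max_mem)
    also have "int (nat (R - 1)) * (x + int t * R) + int t * R
        = - x + int u * R"
      using R_pos by (simp add: u algebra_simps)
    finally show ?thesis by (auto simp: G_def)
  qed
  have mult_nat: "int c * x \<in> G" if "x \<in> G" for c x
    by (induction c) (auto simp: algebra_simps zero that intro: add)
  have mult: "c * x \<in> G" if x: "x \<in> G" for c x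
  proof (cases "0 \<le> c")
    case True
    then show ?thesis using mult_nat[OF x, of "nat c"] by simp
  next
    case False
    then show ?thesis using neg[OF mult_nat[OF x, of "nat (- c)"]] by simp
  qed
  have "Gcd B \<in> G" if "finite B" "B \<subseteq> G" for B
    using that
  proof (induction B rule: finite_induct)
    case empty
    show ?case by (simp add: zero)
  next
    case (insert b B)
    obtain u v where "u * b + v * Gcd B = gcd b (Gcd B)" using bezout_int by blast
    then show ?case using insert add mult by (metis Gcd_insert insert_subset)
  qed
  moreover have "A \<subseteq> G" using generator_S by (auto simp: G_def intro!: exI[of _ 0])
  ultimately have "d \<in> G" using finite_A by blast
  then have "x \<in> G" using assms mult by (metis dvd_def mult.commute)
  then show ?thesis by (simp add: G_def)
qed

lemma gaps_bounded: "\<exists>B. \<forall>x. d dvd x \<longrightarrow> x \<notin> S \<longrightarrow> x < B"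
proof -
  obtain t where t: "\<And>x. d dvd x \<Longrightarrow> x + int (t x) * R \<in> S" using eventually_S by metis
  define T where "T = Max (t ` {0..<R})"
  have "x \<in> S" if x: "d dvd x" "int T * R + R \<le> x" for x
  proof -
    define y where "y = x mod R"
    have y: "0 \<le> y" "y < R" using R_pos by (auto simp: y_def)
    have "d dvd y" using x(1) dvd_R by (simp add: y_def dvd_mod)
    then have "y + int (t y) * R \<in> S" by (rule t)
    have "t y \<le> T" unfolding T_def using y by (intro Max_ge) auto
    moreover have "int T < x div R"
    proof -
      have "int T * R + R \<le> (x div R) * R + y" using x(2) by (simp add: y_def)
      then have "int T * R < (x div R) * R" using y by linarith
      then show ?thesis using R_pos by simp
    qed
    ultimately have "0 \<le> x div R - int (t y)" by linarith
    then have "(y + int (t y) * R) + int (nat (x div R - int (t y))) * R = x"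
      using div_mult_mod_eq[of x R] by (simp add: y_def algebra_simps)
    moreover have "(y + int (t y) * R) + int (nat (x div R - int (t y))) * R \<in> S"
      using \<open>y + int (t y) * R \<in> S\<close> by (rule S_add) (intro S_multiple generator_S max_mem)
    ultimately show ?thesis by (simp only:)
  qed
  then show ?thesis by (intro exI[of _ "int T * R + R"]) force
qed

text \<open>The set of gaps contains \<open>- d\<close> and is bounded above, so \<^const>\<open>frobenius\<close> is a genuine
  maximum.\<close>

lemma gap_le_frobenius:
  assumes "d dvd x" "x \<notin> S"
  shows "x \<le> frobenius S"
proof -
  define Q where "Q s \<longleftrightarrow> s \<notin> S \<and> [s = 0] (mod (Gcd S))" for s
  have Q: "Q s \<longleftrightarrow> d dvd s \<and> s \<notin> S" for s
    by (auto simp: Q_def Gcd_S cong_0_iff)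
  obtain B where B: "\<And>s. Q s \<Longrightarrow> s < B" using gaps_bounded Q by blast
  define X where "X = {s. Q s \<and> x \<le> s}"
  have "finite X" using B by (intro finite_subset[of X "{x..B}"]) (force simp: X_def)+
  moreover have xX: "x \<in> X" using assms Q by (simp add: X_def)
  ultimately have mx: "Max X \<in> X" "\<And>s. s \<in> X \<Longrightarrow> s \<le> Max X"
    using Max_in[of X] by (blast, simp)
  have "(GREATEST s. Q s) = Max X"
  proof (rule Greatest_equality)
    show "Q (Max X)" using mx(1) by (simp add: X_def)
    fix s assume "Q s"
    then show "s \<le> Max X" using mx(2)[of s] mx(2)[OF xX] by (cases "x \<le> s") (auto simp: X_def)
  qed
  then show ?thesis using mx(2)[OF xX] unfolding frobenius_def Q_def by simp
qed

section \<open>Pseudo-Frobenius numbers of a shifted monoid\<close>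

lemma shifted_iff: "x \<in> shifted n \<longleftrightarrow> (\<exists>L. \<exists>s\<in>sums_of A L. x = int L * n + s)"
  unfolding shifted_def sums_of_shift by blast

lemma shifted_add: "x \<in> shifted n \<Longrightarrow> y \<in> shifted n \<Longrightarrow> x + y \<in> shifted n"
  unfolding shifted_def by (rule Union_sums_of_add)

lemma shifted_generator: "a \<in> A \<Longrightarrow> n + a \<in> shifted n"
  unfolding shifted_def by (rule UN_I, rule UNIV_I, rule sums_of_single, rule imageI)

end

locale large_shift = generators +
  fixes n :: int
  assumes n_large: "R\<^sup>2 < n" "R\<^sup>2 + frobenius S * R < n" and coprime: "coprime n d"
begin

lemma n_pos: "0 < n"
  using n_large(1) by (meson less_le_trans not_le zero_le_power2)

lemma n_le_dn: "n \<le> d * n"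
  using n_pos d_pos by simp

text \<open>In particular \<open>d * n \<in> S\<close>; the extra room of \<open>R\<close> is for the passage from \<open>n + R\<close> back to
  \<open>n\<close>, where \<open>d * R\<close> is subtracted from numbers that are at least \<open>d * (n + R) - R\<close>.\<close>

lemma S_if_ge: assumes "d dvd x" "d * n - R \<le> x" shows "x \<in> S"
proof (rule ccontr)
  assume "x \<notin> S"
  then have F: "d * n - R \<le> frobenius S" using gap_le_frobenius assms by fastforce
  have R2: "R \<le> R\<^sup>2" using R_pos by (simp add: power2_eq_square)
  show False
  proof (cases "frobenius S \<le> 0")
    case True
    then show False using F R2 n_le_dn n_large(1) by linarith
  next
    case False
    then have "frobenius S * 1 \<le> frobenius S * R" using R_pos by (intro mult_left_mono) auto
    then show False using F R2 n_le_dn n_large(2) by linarith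
  qed
qed

abbreviation "Apery \<equiv> Ap S (d * n)"

lemma Apery_S: "i \<in> Apery \<Longrightarrow> i \<in> S"
  by (simp add: Ap_def)

text \<open>Elements of \<open>S\<close> that are congruent modulo \<open>n\<close> are congruent modulo \<open>d * n\<close>, because \<open>d\<close>
  divides both. As \<open>d * n \<in> S\<close>, an Apery element is the least element of \<open>S\<close> in its class.\<close>

lemma Apery_cong_eq:
  assumes "i \<in> S" "j \<in> Apery" "[i = j] (mod n)"
  obtains e where "0 \<le> e" "i = j + e * (d * n)"
proof -
  have "n dvd i - j" using assms(3) by (simp add: cong_iff_dvd_diff)
  moreover have "d dvd i - j" using assms Apery_S d_dvd_S by auto
  ultimately have "d * n dvd i - j"
    using coprime by (intro divides_mult) (auto simp: coprime_commute)
  then obtain e where e: "i - j = (d * n) * e" by (auto elim: dvdE)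
  have "0 \<le> e"
  proof (rule ccontr)
    assume "\<not> 0 \<le> e"
    then have eq: "j - d * n = i + int (nat (- e - 1)) * (d * n)" using e by (simp add: algebra_simps)
    have "j - d * n \<in> S"
      unfolding eq using R_pos by (intro S_add S_multiple assms(1) S_if_ge) auto
    then show False using assms(2) by (simp add: Ap_def)
  qed
  then show thesis using that[of e] e by (simp add: algebra_simps)
qed

lemma Apery_cong_unique:
  assumes "i \<in> Apery" "j \<in> Apery" "[i = j] (mod n)"
  shows "i = j"
proof -
  obtain e where e: "0 \<le> e" "i = j + e * (d * n)"
    using Apery_cong_eq[OF Apery_S assms(2,3)] assms(1) by blast
  obtain e' where e': "0 \<le> e'" "j = i + e' * (d * n)"
    using Apery_cong_eq[OF Apery_S assms(1)] assms(2,3) by (metis cong_sym)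
  have "0 \<le> e * (d * n)" "0 \<le> e' * (d * n)" using e(1) e'(1) n_pos n_le_dn by auto
  then show ?thesis using e(2) e'(2) by linarith
qed

text \<open>Since \<open>s / R \<le> len s\<close> and \<open>len t < t / R + R\<close>, a distance of about \<open>d * n > R\<^sup>2\<close> forces
  the order of the lengths. The slack \<open>R\<close> leaves room for one
  generator added to \<open>s\<close>.\<close>

lemma len_diff_dn:
  assumes "s \<in> S" "t \<in> S" "t + d * n \<le> s + R"
  shows "len t \<le> len s"
proof -
  have "int (len t) * R \<le> t + R\<^sup>2 - R" by (rule len_R_le[OF assms(2)])
  also have "\<dots> \<le> s" using assms(3) n_large(1) n_le_dn by linarith
  also have "s \<le> int (len s) * R" by (rule le_len_R[OF assms(1)])
  finally show ?thesis using R_pos by simp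
qed

text \<open>This says that \<open>i + len i * n\<close> is the smallest element of \<open>shifted n\<close> in the class of \<open>i\<close>. Another
  representation \<open>L * n + s\<close> has \<open>s = i + e * d * n\<close> with \<open>e \<ge> 0\<close>, and if \<open>e > 0\<close> then \<open>s\<close> is so
  much larger than \<open>i\<close> that \<open>L \<ge> len s \<ge> len i\<close>.\<close>

lemma Apery_mem_shifted_iff:
  assumes "i \<in> Apery"
  shows "i + c * n \<in> shifted n \<longleftrightarrow> int (len i) \<le> c"
proof
  assume "int (len i) \<le> c"
  then have "i \<in> sums_of A (nat c)" using Apery_S[OF assms] by (simp add: sums_of_iff)
  moreover have "i + c * n = int (nat c) * n + i" using \<open>int (len i) \<le> c\<close> by simp
  ultimately show "i + c * n \<in> shifted n" unfolding shifted_iff by blast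
next
  assume "i + c * n \<in> shifted n"
  then obtain L s where "s \<in> sums_of A L" "i + c * n = int L * n + s"
    unfolding shifted_iff by blast
  then have Ls: "s \<in> S" "len s \<le> L" "i + c * n = int L * n + s" by (simp_all add: sums_of_iff)
  then have eq: "s = i + (c - int L) * n" by (simp add: algebra_simps)
  then have "[s = i] (mod n)" by (simp add: cong_iff_dvd_diff)
  then obtain e where e: "0 \<le> e" "s = i + e * (d * n)"
    using Apery_cong_eq[OF Ls(1) assms] by blast
  then have "(c - int L) * n = (e * d) * n" using eq by simp
  then have cL: "c = int L + e * d" using n_pos by simp
  show "int (len i) \<le> c"
  proof (cases "e = 0")
    case True
    then show ?thesis using cL Ls(2) e(2) by simp
  next
    case False
    then have "1 * (d * n) \<le> e * (d * n)" using e(1) n_pos n_le_dn by (intro mult_right_mono) auto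
    then have "len i \<le> len s"
      using e(2) R_pos by (intro len_diff_dn Ls(1) Apery_S[OF assms]) auto
    moreover have "0 \<le> e * d" using e(1) d_pos by simp
    ultimately show ?thesis using cL Ls(2) by linarith
  qed
qed

lemma shifted_Apery_form:
  assumes "w \<in> shifted n"
  obtains i c where "i \<in> Apery" "w = i + c * n"
proof -
  have rep: "\<exists>i\<in>Apery. [s = i] (mod n)" if "s \<in> S" for s
    using that
  proof (induction "nat s" arbitrary: s rule: less_induct)
    case less
    show ?case
    proof (cases "s - d * n \<in> S")
      case True
      have "nat (s - d * n) < nat s" using S_nonneg[OF True] n_pos n_le_dn by linarith
      then obtain i where "i \<in> Apery" "[s - d * n = i] (mod n)" using less True by blast
      moreover have "[s = s - d * n] (mod n)" by (simp add: cong_iff_dvd_diff)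
      ultimately show ?thesis using cong_trans by blast
    next
      case False
      then show ?thesis using less.prems by (auto simp: Ap_def)
    qed
  qed
  obtain L s where "s \<in> sums_of A L" and w: "w = int L * n + s"
    using assms unfolding shifted_iff by blast
  then have "s \<in> S" by (simp add: sums_of_iff)
  then obtain i where i: "i \<in> Apery" "[s = i] (mod n)" using rep by blast
  obtain q where "s - i = n * q" using i(2) by (auto simp: cong_iff_dvd_diff elim: dvdE)
  then have "w = i + (int L + q) * n" using w by (simp add: algebra_simps)
  then show thesis using that i(1) by blast
qed

text \<open>These are the \<open>i\<close> for which \<open>i + len i * n\<close> is maximal, with respect to divisibility in
  the monoid, among the elements \<open>w\<close> of \<open>shifted n\<close> with \<open>w - n \<notin> shifted n\<close>. By \<open>PF_shifted\<close>
  they index the pseudo-Frobenius numbers.\<close>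

definition maximal :: "int set" where
  "maximal = {i \<in> Apery. \<forall>a\<in>A. a \<noteq> 0 \<longrightarrow> i + a \<in> Apery \<longrightarrow> len (i + a) \<le> len i}"

definition pf_of :: "int \<Rightarrow> int" where
  "pf_of i = i + (int (len i) - 1) * n"

lemma pf_of_cong: "[pf_of i = i] (mod n)"
  by (simp add: pf_of_def cong_iff_dvd_diff)

lemma pf_of_cong_iff: "[pf_of i = j] (mod n) \<longleftrightarrow> [i = j] (mod n)"
  using pf_of_cong[of i] by (simp add: cong_def)

text \<open>If \<open>s = i + a - d * n\<close> is in \<open>S\<close>, then \<open>s\<close> lies so far below \<open>i\<close> that \<open>len s \<le> len i\<close>, and
  the left-hand side holds without any condition on \<open>i\<close>.\<close>

lemma pf_of_add_generator_iff:
  assumes "i \<in> Apery" "a \<in> A"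
  shows "pf_of i + (n + a) \<in> shifted n \<longleftrightarrow> (i + a \<in> Apery \<longrightarrow> len (i + a) \<le> len i)"
proof (cases "i + a \<in> Apery")
  case True
  have eq: "pf_of i + (n + a) = (i + a) + int (len i) * n" by (simp add: pf_of_def algebra_simps)
  show ?thesis unfolding eq Apery_mem_shifted_iff[OF True] using True by simp
next
  case False
  define s where "s = i + a - d * n"
  have s: "s \<in> S"
    using False S_add[OF Apery_S[OF assms(1)] generator_S[OF assms(2)]] by (auto simp: Ap_def s_def)
  have "len s \<le> len i"
    using bounds[OF assms(2)] by (intro len_diff_dn s Apery_S assms(1)) (simp add: s_def)
  then have "s \<in> sums_of A (len i + nat d)" using s by (simp add: sums_of_iff)
  moreover have "pf_of i + (n + a) = int (len i + nat d) * n + s"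
    using d_pos by (simp add: pf_of_def s_def algebra_simps)
  ultimately have "pf_of i + (n + a) \<in> shifted n" unfolding shifted_iff by blast
  then show ?thesis using False by simp
qed

lemma generator_pos: "a \<in> A \<Longrightarrow> 0 < n + a"
  using bounds n_pos by fastforce

text \<open>If \<open>f\<close> is pseudo-Frobenius, then \<open>f + n\<close> is the least element of \<open>shifted n\<close> in its class
  modulo \<open>n\<close>, so \<open>f = pf_of i\<close>. The defining condition of \<open>PF\<close> for arbitrary nonzero \<open>h\<close> follows
  from the one for generators, as \<open>h\<close> is a generator plus an element of the monoid.\<close>

lemma PF_shifted: "PF (shifted n) = pf_of ` maximal"
proof
  show "PF (shifted n) \<subseteq> pf_of ` maximal"
  proof
    fix f assume f: "f \<in> PF (shifted n)"
    have gen: "f + (n + a) \<in> shifted n" if "a \<in> A" for a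
      using f shifted_generator[OF that] generator_pos[OF that] by (simp add: PF_def)
    obtain i c where ic: "i \<in> Apery" "f + (n + 0) = i + c * n"
      using shifted_Apery_form[OF gen[OF zero_mem]] by blast
    have "f = i + (c - 1) * n" using ic(2) by (simp add: algebra_simps)
    then have "c - 1 < int (len i)"
      using f Apery_mem_shifted_iff[OF ic(1)] by (simp add: PF_def not_le)
    moreover have "int (len i) \<le> c"
      using gen[OF zero_mem] ic Apery_mem_shifted_iff[OF ic(1)] by simp
    ultimately have fi: "f = pf_of i" using \<open>f = i + (c - 1) * n\<close> by (simp add: pf_of_def)
    then have "i \<in> maximal"
      using gen pf_of_add_generator_iff[OF ic(1)] ic(1) by (auto simp: maximal_def)
    then show "f \<in> pf_of ` maximal" using fi by blast
  qed
  show "pf_of ` maximal \<subseteq> PF (shifted n)"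
  proof
    fix f assume "f \<in> pf_of ` maximal"
    then obtain i where i: "i \<in> maximal" "f = pf_of i" by blast
    have iA: "i \<in> Apery" using i(1) by (simp add: maximal_def)
    have "f \<notin> shifted n" using Apery_mem_shifted_iff[OF iA] i(2) by (simp add: pf_of_def)
    moreover have "f + h \<in> shifted n" if h: "h \<in> shifted n" "h \<noteq> 0" for h
    proof -
      obtain L where L: "h \<in> sums_of ((\<lambda>a. n + a) ` A) L" using h(1) by (auto simp: shifted_def)
      obtain L' where "L = Suc L'" using L h(2) by (cases L) (auto simp: sums_of_def)
      then obtain a h' where ah: "a \<in> A" "h' \<in> shifted n" "h = n + a + h'"
        using L by (auto simp: shifted_def elim!: sums_of_SucE)
      have "f + (n + a) \<in> shifted n"
        unfolding i(2) pf_of_add_generator_iff[OF iA ah(1)]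
        using i(1) ah(1) by (cases "a = 0") (auto simp: maximal_def)
      then have "f + (n + a) + h' \<in> shifted n" by (rule shifted_add[OF _ ah(2)])
      then show ?thesis using ah(3) by (simp add: add.assoc)
    qed
    ultimately show "f \<in> PF (shifted n)" by (simp add: PF_def)
  qed
qed

lemma maximal_cong_unique:
  "i \<in> maximal \<Longrightarrow> j \<in> maximal \<Longrightarrow> [i = j] (mod n) \<Longrightarrow> i = j"
  by (rule Apery_cong_unique) (simp_all add: maximal_def)

lemma bij_pf_of: "bij_betw pf_of maximal (PF (shifted n))"
  unfolding PF_shifted
proof (rule inj_on_imp_bij_betw, rule inj_onI)
  fix i j assume ij: "i \<in> maximal" "j \<in> maximal" "pf_of i = pf_of j"
  have "[pf_of i = j] (mod n)" unfolding ij(3) by (rule pf_of_cong)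
  with ij(1,2) show "i = j" unfolding pf_of_cong_iff by (rule maximal_cong_unique)
qed

lemma maximal_eq: "maximal = {i \<in> Apery. \<exists>f\<in>PF (shifted n). [f = i] (mod n)}"
proof (intro set_eqI iffI)
  fix i assume "i \<in> maximal"
  then show "i \<in> {i \<in> Apery. \<exists>f\<in>PF (shifted n). [f = i] (mod n)}"
    using PF_shifted pf_of_cong by (auto simp: maximal_def)
next
  fix i assume "i \<in> {i \<in> Apery. \<exists>f\<in>PF (shifted n). [f = i] (mod n)}"
  then obtain j where j: "i \<in> Apery" "j \<in> maximal" "[pf_of j = i] (mod n)"
    unfolding PF_shifted by blast
  have "j \<in> Apery" using j(2) by (simp add: maximal_def)
  then have "j = i" using j(1,3) unfolding pf_of_cong_iff by (rule Apery_cong_unique)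
  then show "i \<in> maximal" using j(2) by simp
qed

text \<open>Between the two bounds, adding the generator \<open>R\<close> stays in the Apery set and increases the length.\<close>

lemma not_maximal_below:
  assumes "i \<in> maximal" "R\<^sup>2 - R < i"
  shows "d * n - R \<le> i"
proof (rule ccontr)
  assume "\<not> d * n - R \<le> i"
  have i: "i \<in> S" using assms(1) by (simp add: maximal_def Ap_def)
  have "i + R - d * n \<notin> S" using \<open>\<not> d * n - R \<le> i\<close> S_nonneg[of "i + R - d * n"] by linarith
  then have "i + R \<in> Apery" using S_add[OF i generator_S[OF max_mem]] by (simp add: Ap_def)
  then have "len (i + R) \<le> len i" using assms(1) max_mem R_pos by (auto simp: maximal_def)
  then show False using len_add_R[OF i assms(2)] by simp
qed

section \<open>From one shift to the next\<close>

lemma large_shift_add: "large_shift A R (n + R)"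
proof
  show "R\<^sup>2 < n + R" "R\<^sup>2 + frobenius S * R < n + R" using n_large R_pos by linarith+
  obtain q where "R = d * q" using dvd_R by (auto elim: dvdE)
  then have "gcd d (n + R) = gcd d n"
    using gcd_add_mult[of d q n] by (simp add: mult.commute add.commute)
  then show "coprime (n + R) d"
    using coprime by (simp add: coprime_iff_gcd_eq_1 gcd.commute)
qed

text \<open>Adding a generator to such an \<open>i\<close> does not reach \<open>d * n\<close>, so all of \<open>S\<close> there belongs to the
  Apery set. The right-hand side does not mention \<open>n\<close>.\<close>

lemma maximal_below_iff:
  assumes "i < d * n - R"
  shows "i \<in> maximal \<longleftrightarrow> i \<in> S \<and> (\<forall>a\<in>A. a \<noteq> 0 \<longrightarrow> len (i + a) \<le> len i)"
proof -
  have "i + a \<in> Apery" if "a \<in> A" "i \<in> S" for a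
  proof -
    have "i + a - d * n \<notin> S"
      using assms bounds[OF that(1)] S_nonneg[of "i + a - d * n"] by linarith
    then show ?thesis using S_add[OF that(2) generator_S[OF that(1)]] by (simp add: Ap_def)
  qed
  from this this[OF zero_mem] show ?thesis
    by (auto simp: maximal_def Apery_S)
qed

text \<open>Apery sets for \<open>d * n\<close> and \<open>d * (n + R)\<close> correspond at their upper ends under translation
  by \<open>d * R\<close>, and there this translation adds \<open>d\<close> to every length.\<close>

lemma maximal_above_iff:
  assumes "d * n - R \<le> i"
  shows "i \<in> maximal \<longleftrightarrow> i + d * R \<in> large_shift.maximal A (n + R)"
proof -
  interpret nxt: large_shift A R "n + R" by (rule large_shift_add)
  have dvd: "x \<in> S \<Longrightarrow> d dvd x" for x by (rule d_dvd_S)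
  have mem: "i + a \<in> S \<longleftrightarrow> i + a + d * R \<in> S" if "a \<in> A" for a
  proof
    assume "i + a \<in> S"
    then have "i + a + int (nat d) * R \<in> S"
      by (rule S_add) (intro S_multiple generator_S max_mem)
    then show "i + a + d * R \<in> S" using d_pos by simp
  next
    assume "i + a + d * R \<in> S"
    then have "d dvd i + a" by (metis dvd dvd_add_left_iff dvd_triv_left)
    then show "i + a \<in> S" using assms bounds[OF that] by (intro S_if_ge) auto
  qed
  have Ap: "i + a \<in> Apery \<longleftrightarrow> i + d * R + a \<in> nxt.Apery" if "a \<in> A" for a
    using mem[OF that] by (simp add: Ap_def algebra_simps)
  have len: "len (i + d * R + a) = len (i + a) + nat d" if "a \<in> A" "i + a \<in> S" for a
  proof -
    have "R\<^sup>2 - R < i + a" using assms n_large(1) n_le_dn bounds[OF that(1)] by linarith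
    then have "len (i + a + int (nat d) * R) = len (i + a) + nat d"
      by (rule len_add_multiple_R[OF that(2)])
    then show ?thesis using d_pos by (simp add: algebra_simps)
  qed
  have "i \<in> Apery \<longleftrightarrow> i + d * R \<in> nxt.Apery" using Ap[OF zero_mem] by simp
  moreover have "i + a \<in> Apery \<longrightarrow> (len (i + a) \<le> len i \<longleftrightarrow> len (i + d * R + a) \<le> len (i + d * R))"
    if "a \<in> A" "i \<in> Apery" for a
    using len[OF that(1)] len[OF zero_mem] Apery_S that(2) by auto
  ultimately show ?thesis
    unfolding maximal_def nxt.maximal_def using Ap by blast
qed

definition lift :: "int \<Rightarrow> int" where
  "lift i = (if i < d * n - R then i else i + d * R)"

text \<open>The values of \<open>lift\<close> leave out exactly the interval from \<open>d * n - R\<close> to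
  \<open>d * (n + R) - R\<close>, which by \<open>not_maximal_below\<close> contains no maximal element for
  \<open>n + R\<close>.\<close>

lemma bij_lift: "bij_betw lift maximal (large_shift.maximal A (n + R))"
proof -
  interpret nxt: large_shift A R "n + R" by (rule large_shift_add)
  have dR: "0 < d * R" using d_pos R_pos by simp
  have below: "i \<in> maximal \<longleftrightarrow> i \<in> nxt.maximal" if "i < d * n - R" for i
    using that dR maximal_below_iff[OF that] nxt.maximal_below_iff[of i]
    by (simp add: algebra_simps)
  show ?thesis
  proof (rule bij_betw_imageI)
    show "inj_on lift maximal"
      using dR by (auto simp: inj_on_def lift_def split: if_splits)
    show "lift ` maximal = nxt.maximal"
    proof safe
      fix i assume "i \<in> maximal"
      then show "lift i \<in> nxt.maximal"
        using below maximal_above_iff[of i] by (cases "i < d * n - R") (auto simp: lift_def)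
    next
      fix j assume j: "j \<in> nxt.maximal"
      show "j \<in> lift ` maximal"
      proof (cases "j < d * n - R")
        case True
        then show ?thesis using j below by (intro image_eqI[of _ _ j]) (auto simp: lift_def)
      next
        case False
        then have "R\<^sup>2 - R < j" using n_large(1) n_le_dn by linarith
        then have "d * (n + R) - R \<le> j" by (rule nxt.not_maximal_below[OF j])
        then have "d * n - R \<le> j - d * R" by (simp add: algebra_simps)
        moreover from this have "j - d * R \<in> maximal" using maximal_above_iff j by simp
        ultimately show ?thesis by (intro image_eqI[of _ _ "j - d * R"]) (auto simp: lift_def)
      qed
    qed
  qed
qed

end

theorem theorem2p1:
  fixes k :: nat and r :: "nat \<Rightarrow> int" and n :: int
  assumes "k \<ge> 2"
    and "r 0 = 0" and "\<forall>i<k. r i < r (Suc i)"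
    and "n > 0" and "n > N0 k r" and "coprime n (gcd_shifts k r)"
  shows "bij_betw (psi k r n) (P k r n) (P k r (n + r k)) \<and>
    (\<forall>f\<in>PF (M k r n). \<exists>!i. i \<in> P k r n \<and> [f = i] (mod n)) \<and>
    (\<exists>\<phi>. bij_betw \<phi> (PF (M k r n)) (PF (M k r (n + r k))) \<and>
      (\<forall>f\<in>PF (M k r n). \<forall>i\<in>P k r n. [f = i] (mod n) \<longrightarrow>
        (\<forall>g\<in>PF (M k r (n + r k)). [g = psi k r n i] (mod (n + r k)) \<longleftrightarrow> g = \<phi> f)))"
proof -
  define A where "A = r ` {0..k}"
  have mono: "i \<le> j \<Longrightarrow> j \<le> k \<Longrightarrow> r i \<le> r j" for i j
  proof (induction j rule: dec_induct)
    case (step j)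
    then show ?case using assms(3) by (meson Suc_leD Suc_le_lessD less_imp_le order_trans)
  qed simp
  have "r 0 < r 1" "r 1 \<le> r k" using assms(1,3) mono by auto
  then have "0 < r k" using assms(2) by simp
  interpret gens: generators A "r k"
  proof
    show "0 \<in> A" using assms(2) unfolding A_def by (intro image_eqI[of _ _ 0]) auto
    show "r k \<in> A" by (simp add: A_def)
    show "0 < r k" by fact
    show "0 \<le> a \<and> a \<le> r k" if "a \<in> A" for a
      using that mono[of 0] mono[of _ k] assms(2) by (auto simp: A_def)
  qed
  have A_insert: "A = insert 0 (r ` {1..k})"
    using assms(2) by (auto simp: A_def image_iff not_less_eq_eq intro: bexI[of _ 0])
      (metis One_nat_def Suc_leI atLeastAtMost_iff gr0I)
  have d: "gcd_shifts k r = Gcd A" by (simp add: A_insert gcd_shifts_def)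
  have S: "shift_monoid k r = gens.S"
  proof
    show "shift_monoid k r \<subseteq> gens.S"
    proof -
      have "sums_of (r ` {1..k}) L \<subseteq> sums_of A L" for L
        unfolding A_insert sums_of_def by blast
      then show ?thesis
        unfolding shift_monoid_def gens.S_def gen_monoid_eq_sums_of[OF finite_atLeastAtMost]
        by blast
    qed
    have "s \<in> shift_monoid k r" if "s \<in> sums_of A L" for s L
      using that
    proof (induction L arbitrary: s)
      case 0
      then have "s \<in> sums_of (r ` {1..k}) 0" by (auto simp: sums_of_def)
      then show ?case
        unfolding shift_monoid_def gen_monoid_eq_sums_of[OF finite_atLeastAtMost] by blast
    next
      case (Suc L)
      obtain a t where at: "a \<in> A" "t \<in> sums_of A L" "s = a + t"
        by (rule sums_of_SucE[OF Suc.prems])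
      then have "t \<in> shift_monoid k r" using Suc.IH by blast
      with at show ?case
        unfolding A_insert shift_monoid_def by (auto intro: gen_monoid_add_generator)
    qed
    then show "gens.S \<subseteq> shift_monoid k r" by (auto simp: gens.S_def)
  qed
  have M: "M k r m = gens.shifted m" for m
  proof -
    have "(\<lambda>i. m + r i) ` {0..k} = (\<lambda>a. m + a) ` A" by (simp add: A_def image_image)
    then show ?thesis
      by (simp only: M_def gens.shifted_def gen_monoid_eq_sums_of[OF finite_atLeastAtMost])
  qed
  interpret large_shift A "r k" n
    using assms(5,6) by unfold_locales (auto simp: N0_def S d)
  interpret nxt: large_shift A "r k" "n + r k" by (rule large_shift_add)
  have P: "P k r n = maximal" "P k r (n + r k) = nxt.maximal"
    unfolding P_def M S d maximal_eq nxt.maximal_eq by simp_all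
  have psi: "psi k r n = lift" by (simp add: fun_eq_iff psi_def lift_def d)
  define res where "res = the_inv_into maximal pf_of"
  have res: "bij_betw res (PF (gens.shifted n)) maximal"
    unfolding res_def by (rule bij_betw_the_inv_into[OF bij_pf_of])
  have res_pf: "pf_of (res f) = f" if "f \<in> PF (gens.shifted n)" for f
    using that bij_pf_of unfolding res_def by (simp add: f_the_inv_into_f_bij_betw)
  have res_cong: "[f = i] (mod n) \<longleftrightarrow> i = res f"
    if "f \<in> PF (gens.shifted n)" "i \<in> maximal" for f i
  proof -
    have "[f = i] (mod n) \<longleftrightarrow> [res f = i] (mod n)"
      using pf_of_cong_iff[of "res f" i] res_pf[OF that(1)] by simp
    moreover have "res f \<in> maximal" using res that(1) by (auto simp: bij_betw_def)
    ultimately show ?thesis using maximal_cong_unique[of "res f" i] that(2) by auto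
  qed
  define \<phi> where "\<phi> = nxt.pf_of \<circ> lift \<circ> res"
  have "bij_betw \<phi> (PF (gens.shifted n)) (PF (gens.shifted (n + r k)))"
    unfolding \<phi>_def
    by (intro bij_betw_trans[OF res] bij_betw_trans[OF bij_lift] nxt.bij_pf_of)
  moreover have "[g = lift i] (mod (n + r k)) \<longleftrightarrow> g = \<phi> f"
    if f: "f \<in> PF (gens.shifted n)" "i \<in> maximal" "[f = i] (mod n)"
      and g: "g \<in> PF (gens.shifted (n + r k))" for f i g
  proof -
    have \<phi>: "\<phi> f = nxt.pf_of (lift i)" using res_cong[OF f(1,2)] f(3) by (simp add: \<phi>_def)
    have li: "lift i \<in> nxt.maximal" using bij_lift f(2) by (auto simp: bij_betw_def)
    obtain j where j: "j \<in> nxt.maximal" "g = nxt.pf_of j"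
      using g nxt.PF_shifted by blast
    have "[g = lift i] (mod (n + r k)) \<longleftrightarrow> [j = lift i] (mod (n + r k))"
      by (simp only: j(2) nxt.pf_of_cong_iff)
    also have "\<dots> \<longleftrightarrow> j = lift i" using nxt.maximal_cong_unique[OF j(1) li] by auto
    also have "\<dots> \<longleftrightarrow> g = \<phi> f"
      unfolding \<phi> j(2) using nxt.bij_pf_of j(1) li by (auto simp: bij_betw_def dest: inj_onD)
    finally show ?thesis .
  qed
  moreover have "\<exists>!i. i \<in> maximal \<and> [f = i] (mod n)" if "f \<in> PF (gens.shifted n)" for f
    using res_cong[OF that] res that by (auto simp: bij_betw_def)
  ultimately show ?thesis
    unfolding P psi M using bij_lift by blast
qed

end
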